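(* Let $d=3k$ where $k$ is an odd integer and $k\ge3$. Then the following $(d,\Pi)$ is exceptional for branched covers $\mathbb S^2\to\mathbb S^2$: $$\Pi=[(k-2,\ \underbrace{2,\dots,2}_{k+1}),\ (\underbrace{3,\dots,3}_{k}),\ (\underbrace{3,\dots,3}_{k})].$$
   Context: A branched cover $f:\mathbb S^2\to\mathbb S^2$ of degree $d$ is a non-constant holomorphic map of the Riemann sphere of degree $d$. Near each point $q$ of the source it has, in suitable local holomorphic coordinates, the form $z\mapsto z^{e_q}$, where $e_q\in\mathbb N$ is the local ramification index. The branching points are the images of the points with $e_q\ge2$. A candidate branch datum $(d,\Pi)$ consists of $d\in\mathbb N$ and a list of $n$ tuples of positive integers $\Pi=[(\Pi_1^1,\dots,\Pi_1^{\ell_1}),\dots,(\Pi_n^1,\dots,\Pi_n^{\ell_n})]$ such that for each $i$ at least one $\Pi_i^j\ge2$, $\sum_j\Pi_i^j=d$ for each $i$, and $2=2d-\sum_{i=1}^n\sum_{j=1}^{\ell_i}(\Pi_i^j-1)$ (Riemann–Hurwitz). It is realized by a branched cover $f:\mathbb S^2\to\mathbb S^2$ of degree $d$ if $f$ has exactly $n$ distinct branching points $p_1,\dots,p_n$ and, for each $i$, the preimage $f^{-1}(p_i)$ consists of $\ell_i$ points with local ramification indices $\Pi_i^1,\dots,\Pi_i^{\ell_i}$ (up to order). The datum is exceptional if it is a candidate branch datum that is not realized by any branched cover $\mathbb S^2\to\mathbb S^2$. An underbrace with a number indicates how many entries are in the underbraced list. *)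

theory Defs
  imports "HOL-Complex_Analysis.Complex_Analysis" "HOL-Library.Multiset"
begin

text \<open>The point at infinity is \<^term>\<open>None\<close>.\<close>

type_synonym sphere = "complex option"

definition sphere_top :: "sphere topology" where
  "sphere_top = Alexandroff_compactification euclidean"

text \<open>
  The complex structure is given by the chart \<open>z\<close> on the complement of infinity, with inverse
  \<^term>\<open>Some\<close>, and the chart \<open>1/z\<close> on the complement of \<open>0\<close>, with inverse \<open>infty_param\<close>.
  The value of a chart at the point missing from its domain is irrelevant.
\<close>

definition finite_chart :: "sphere \<Rightarrow> complex" where
  "finite_chart p = (case p of None \<Rightarrow> 0 | Some z \<Rightarrow> z)"

definition infty_chart :: "sphere \<Rightarrow> complex" where
  "infty_chart p = (case p of None \<Rightarrow> 0 | Some z \<Rightarrow> inverse z)"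

definition infty_param :: "complex \<Rightarrow> sphere" where
  "infty_param w = (if w = 0 then None else Some (inverse w))"

text \<open>Only meant for \<open>U\<close> open in the sphere.\<close>

definition holomorphic_fun_on :: "(sphere \<Rightarrow> complex) \<Rightarrow> sphere set \<Rightarrow> bool" where
  "holomorphic_fun_on g U \<longleftrightarrow>
     (g \<circ> Some) holomorphic_on (Some -` U) \<and>
     (g \<circ> infty_param) holomorphic_on (infty_param -` U)"

definition holomorphic_sphere_map :: "(sphere \<Rightarrow> sphere) \<Rightarrow> bool" where
  "holomorphic_sphere_map f \<longleftrightarrow>
     continuous_map sphere_top sphere_top f \<and>
     holomorphic_fun_on (finite_chart \<circ> f) (f -` (- {None})) \<and>
     holomorphic_fun_on (infty_chart \<circ> f) (f -` (- {Some 0}))"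

text \<open>An injective holomorphic function on an open set is biholomorphic onto its image.\<close>

definition local_coordinate :: "sphere \<Rightarrow> sphere set \<Rightarrow> (sphere \<Rightarrow> complex) \<Rightarrow> bool" where
  "local_coordinate q U \<phi> \<longleftrightarrow>
     openin sphere_top U \<and> q \<in> U \<and> holomorphic_fun_on \<phi> U \<and> inj_on \<phi> U \<and> \<phi> q = 0"

definition has_local_form :: "(sphere \<Rightarrow> sphere) \<Rightarrow> sphere \<Rightarrow> nat \<Rightarrow> bool" where
  "has_local_form f q e \<longleftrightarrow>
     (\<exists>U \<phi> V \<psi>. local_coordinate q U \<phi> \<and> local_coordinate (f q) V \<psi> \<and> f ` U \<subseteq> V \<and>
        (\<forall>x\<in>U. \<psi> (f x) = \<phi> x ^ e))"

text \<open>For a non-constant holomorphic \<open>f\<close> there is exactly one such exponent at every point.\<close>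

definition ramification_index :: "(sphere \<Rightarrow> sphere) \<Rightarrow> sphere \<Rightarrow> nat" where
  "ramification_index f q = (THE e. e \<ge> 1 \<and> has_local_form f q e)"

text \<open>The degree is the number of points in any fibre, counted with multiplicity.\<close>

definition has_degree :: "(sphere \<Rightarrow> sphere) \<Rightarrow> nat \<Rightarrow> bool" where
  "has_degree f d \<longleftrightarrow>
     (\<forall>p. finite (f -` {p}) \<and> (\<Sum>q\<in>f -` {p}. ramification_index f q) = d)"

definition branched_cover :: "(sphere \<Rightarrow> sphere) \<Rightarrow> nat \<Rightarrow> bool" where
  "branched_cover f d \<longleftrightarrow>
     holomorphic_sphere_map f \<and> \<not> f constant_on UNIV \<and> has_degree f d"

definition branching_points :: "(sphere \<Rightarrow> sphere) \<Rightarrow> sphere set" where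
  "branching_points f = f ` {q. ramification_index f q \<ge> 2}"

definition candidate_branch_datum :: "nat \<Rightarrow> nat list list \<Rightarrow> bool" where
  "candidate_branch_datum d P \<longleftrightarrow>
     (\<forall>\<pi>\<in>set P. (\<forall>m\<in>set \<pi>. m \<ge> 1) \<and> (\<exists>m\<in>set \<pi>. m \<ge> 2) \<and> sum_list \<pi> = d) \<and>
     2 = 2 * int d - (\<Sum>\<pi>\<leftarrow>P. \<Sum>m\<leftarrow>\<pi>. int m - 1)"

text \<open>The equation of multisets also fixes the number of points in each fibre.\<close>

definition realized_by :: "nat \<Rightarrow> nat list list \<Rightarrow> (sphere \<Rightarrow> sphere) \<Rightarrow> bool" where
  "realized_by d P f \<longleftrightarrow>
     branched_cover f d \<and>
     (\<exists>ps. distinct ps \<and> length ps = length P \<and> set ps = branching_points f \<and>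
        (\<forall>i<length P.
           image_mset (ramification_index f) (mset_set (f -` {ps ! i})) = mset (P ! i)))"

definition exceptional :: "nat \<Rightarrow> nat list list \<Rightarrow> bool" where
  "exceptional d P \<longleftrightarrow> candidate_branch_datum d P \<and> \<not> (\<exists>f. realized_by d P f)"

end

theory Submission
  imports Defs "HOL-Computational_Algebra.Fundamental_Theorem_Algebra"
begin

text \<open>
  Let \<open>f\<close> realize the datum, with branching points \<open>p1\<close>, \<open>p2\<close>, \<open>p3\<close> in the order of its three
  partitions. If \<open>p1\<close>, \<open>p2\<close>, \<open>p3\<close> are moved to \<open>1\<close>, \<open>0\<close> and infinity, all zeros and poles of
  \<open>f\<close> have multiplicity three, so \<open>f = g ^ 3\<close> for a rational function \<open>g\<close> of degree \<open>k\<close>. The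
  fibre of \<open>f\<close> over \<open>p1\<close> is the disjoint union of the fibres of \<open>g\<close> over the three cube
  roots of unity, and \<open>f\<close> and \<open>g\<close> have the same ramification indices there. In each of these three
  fibres the indices sum to the odd number \<open>k\<close>, so each contains a point of odd index. But the only
  odd entry of the first partition is \<open>k - 2\<close>.

  The proof below avoids the change of coordinates in the target and the count of multiplicities at
  infinity. Writing \<open>f = P / Q\<close> with polynomials without common zeros
  (\<open>holomorphic_sphere_map_rational\<close>), the finite points over \<open>t\<close> are the roots of \<open>P - t Q\<close>, those
  over infinity are the roots of \<open>Q\<close>, and orders of roots are ramification indices
  (\<open>ramification_index_eq_order\<close>). Any three of these polynomials are linearly dependent, so the one
  for \<open>p1\<close> is \<open>a ^ 3 - b ^ 3\<close>, where \<open>a ^ 3\<close> and \<open>b ^ 3\<close> are multiples of those for \<open>p2\<close> and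
  \<open>p3\<close>. It is the product of the polynomials \<open>a - c b\<close> over the cube roots of unity \<open>c\<close>. The larger
  of the degrees of \<open>a\<close> and \<open>b\<close> is \<open>k\<close>, and at most one of the three factors has smaller degree (this
  happens when infinity lies over \<open>p1\<close>). The other two have odd degree, hence a root of odd order each:
  two points of odd index over \<open>p1\<close>, which is already a contradiction
  (\<open>three_divisible_pencil_odd_orders\<close>).
\<close>

section \<open>Differences of cubes of complex polynomials\<close>

lemma degree_eq_sum_order_complex:
  fixes p :: "complex poly"
  assumes "p \<noteq> 0"
  shows "degree p = (\<Sum>z | poly p z = 0. order z p)"
proof -
  have "degree p = size (proots p)"
    by (simp add: size_proots_complex)
  then show ?thesis
    using assms by (simp add: size_multiset_overloaded_eq)
qed

lemma poly_is_power_if_dvd_orders: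
  fixes p :: "complex poly"
  assumes "n > 0" and "\<And>z. poly p z = 0 \<Longrightarrow> n dvd order z p"
  shows "\<exists>r. p = r ^ n"
proof -
  obtain c where c: "lead_coeff p = c ^ n"
    using exists_complex_root[of n "lead_coeff p"] \<open>n > 0\<close> by auto
  have "p = smult (c ^ n) (\<Prod>z | poly p z = 0. [:-z, 1:] ^ order z p)"
    unfolding c[symmetric] by (rule complex_poly_decompose[symmetric])
  also have "(\<Prod>z | poly p z = 0. [:-z, 1:] ^ order z p)
      = (\<Prod>z | poly p z = 0. [:-z, 1:] ^ (order z p div n)) ^ n"
    unfolding prod_power_distrib
    by (rule prod.cong) (use assms in \<open>auto simp flip: power_mult\<close>)
  finally show ?thesis
    by (metis smult_power)
qed

lemma odd_degree_imp_odd_order: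
  fixes p :: "complex poly"
  assumes "odd (degree p)"
  shows "\<exists>z. odd (order z p)"
proof (rule ccontr)
  assume "\<nexists>z. odd (order z p)"
  then have "even (\<Sum>z | poly p z = 0. order z p)"
    by (auto intro: dvd_sum)
  moreover have "p \<noteq> 0" using assms by auto
  ultimately show False
    using assms degree_eq_sum_order_complex by auto
qed

lemma cubic_root_of_unity:
  obtains \<omega> :: complex where "\<omega> ^ 2 + \<omega> + 1 = 0" "\<omega> \<noteq> 1" "\<omega> \<noteq> \<omega> ^ 2" "\<omega> ^ 2 \<noteq> 1"
proof -
  define \<omega> where "\<omega> = Complex (-1/2) (sqrt 3 / 2)"
  have 1: "\<omega> ^ 2 + \<omega> + 1 = 0"
    by (simp add: \<omega>_def complex_eq_iff power2_eq_square)
  have sq: "\<omega> ^ 2 = - 1 - \<omega>" using 1 by (simp add: algebra_simps eq_neg_iff_add_eq_0)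
  show ?thesis
    by (rule that[OF 1]) (unfold sq, simp_all add: \<omega>_def complex_eq_iff)
qed

text \<open>
  The degree drops below \<open>k\<close> exactly when the coefficient of degree \<open>k\<close> vanishes, and \<open>c\<close> is
  then the quotient of the coefficients of \<open>a\<close> and \<open>b\<close> in that degree.
\<close>
lemma pencil_degree_drop_unique:
  fixes a b :: "complex poly"
  assumes "degree a \<le> k" "degree b \<le> k" "degree a = k \<or> degree b = k" "k > 0"
    and "degree (a - smult c b) \<noteq> k" "degree (a - smult c' b) \<noteq> k"
  shows "c = c'"
proof -
  have *: "coeff a k = x * coeff b k" if "degree (a - smult x b) \<noteq> k" for x
  proof -
    have "degree (a - smult x b) \<le> k"
      using assms(1,2) by (intro degree_diff_le) (auto intro: order_trans[OF degree_smult_le])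
    then have "coeff (a - smult x b) k = 0"
      using that by (intro coeff_eq_0) auto
    then show ?thesis by simp
  qed
  have "coeff b k \<noteq> 0"
  proof
    assume "coeff b k = 0"
    with *[OF assms(5)] have "coeff a k = 0" by simp
    with \<open>coeff b k = 0\<close> assms(3,4) show False
      by (metis degree_0 leading_coeff_0_iff less_irrefl)
  qed
  then show ?thesis
    using *[OF assms(5)] *[OF assms(6)] by simp
qed

text \<open>
  Distinct members of the pencil \<open>a - c b\<close> have no common root, so a root of odd order of one of
  the three factors of \<open>a ^ 3 - b ^ 3\<close> has the same order in the product, and roots of different
  factors are different.
\<close>
lemma difference_of_cubes_odd_orders:
  fixes a b :: "complex poly"
  assumes "odd k" "degree a \<le> k" "degree b \<le> k" "degree a = k \<or> degree b = k"
    and coprime: "\<And>z. \<not> (poly a z = 0 \<and> poly b z = 0)"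
  shows "\<exists>z z'. z \<noteq> z' \<and> odd (order z (a ^ 3 - b ^ 3)) \<and> odd (order z' (a ^ 3 - b ^ 3))"
proof -
  obtain \<omega> :: complex where \<omega>: "\<omega> ^ 2 + \<omega> + 1 = 0" "\<omega> \<noteq> 1" "\<omega> \<noteq> \<omega> ^ 2" "\<omega> ^ 2 \<noteq> 1"
    by (rule cubic_root_of_unity)
  define W where "W = {1, \<omega>, \<omega> ^ 2}"
  define l where "l c = a - smult c b" for c
  have factors: "a ^ 3 - b ^ 3 = (\<Prod>c\<in>W. l c)"
  proof (rule poly_eq_poly_eq_iff[THEN iffD1], rule ext)
    fix x
    have "poly (\<Prod>c\<in>W. l c) x = (poly a x - poly b x) * (poly a x - \<omega> * poly b x) * (poly a x - \<omega>^2 * poly b x)"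
      using \<omega> by (simp add: W_def l_def poly_prod mult.assoc)
    also have "\<dots> = poly a x ^ 3 - poly b x ^ 3"
      using \<omega>(1) by algebra
    finally show "poly (a ^ 3 - b ^ 3) x = poly (\<Prod>c\<in>W. l c) x"
      by simp
  qed
  have "k > 0" using \<open>odd k\<close> by (simp add: odd_pos)
  have disj: "poly (l c) z \<noteq> 0 \<or> poly (l c') z \<noteq> 0" if "c \<noteq> c'" for c c' z
  proof (rule ccontr)
    assume "\<not> ?thesis"
    then have "poly a z = c * poly b z" "poly a z = c' * poly b z"
      by (auto simp: l_def)
    then have "poly b z = 0" "poly a z = 0"
      using that by auto
    then show False using coprime by blast
  qed
  have drop: "c = c'" if "degree (l c) \<noteq> k" "degree (l c') \<noteq> k" for c c'
    using pencil_degree_drop_unique[OF assms(2-4) \<open>k > 0\<close>] that unfolding l_def by blast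
  have odd_root: "\<exists>z. poly (l c) z = 0 \<and> odd (order z (a ^ 3 - b ^ 3))" if "c \<in> W" "degree (l c) = k" for c
  proof -
    obtain z where z: "odd (order z (l c))"
      using odd_degree_imp_odd_order \<open>odd k\<close> \<open>degree (l c) = k\<close> by blast
    have lc: "l c \<noteq> 0" using that \<open>k > 0\<close> by auto
    have root: "poly (l c) z = 0" using z order_0I by force
    have nz: "poly (\<Prod>c\<in>W - {c}. l c) z \<noteq> 0"
      using disj[of c] root by (auto simp: poly_prod W_def)
    have "a ^ 3 - b ^ 3 = l c * (\<Prod>c\<in>W - {c}. l c)"
      unfolding factors using \<open>c \<in> W\<close> by (simp add: prod.remove W_def)
    moreover have "l c * (\<Prod>c\<in>W - {c}. l c) \<noteq> 0"
      using lc nz by (metis mult_eq_0_iff poly_0)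
    ultimately have "order z (a ^ 3 - b ^ 3) = order z (l c)"
      using nz by (simp add: order_mult order_0I)
    then show ?thesis using z root by auto
  qed
  have "\<exists>c\<in>W. \<exists>c'\<in>W. c \<noteq> c' \<and> degree (l c) = k \<and> degree (l c') = k"
    using drop[of 1 \<omega>] drop[of 1 "\<omega>^2"] drop[of \<omega> "\<omega>^2"] \<omega> unfolding W_def by auto
  then obtain c c' where c: "c \<in> W" "c' \<in> W" "c \<noteq> c'" "degree (l c) = k" "degree (l c') = k"
    by blast
  obtain z where z: "poly (l c) z = 0" "odd (order z (a ^ 3 - b ^ 3))" using odd_root c by blast
  obtain z' where z': "poly (l c') z' = 0" "odd (order z' (a ^ 3 - b ^ 3))" using odd_root c by blast
  have "z \<noteq> z'" using disj c z z' by blast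
  then show ?thesis using z z' by blast
qed

text \<open>
  Over the complex numbers \<open>\<alpha> A\<close> and \<open>- \<beta> B\<close> are cubes because all their roots have order
  divisible by three; the scalars are absorbed into the cubes.
\<close>
lemma three_divisible_pencil_odd_orders:
  fixes A B C :: "complex poly"
  assumes "odd k" and C: "C = smult \<alpha> A + smult \<beta> B" "\<alpha> \<noteq> 0" "\<beta> \<noteq> 0"
    and coprime: "\<And>z. \<not> (poly A z = 0 \<and> poly B z = 0)"
    and orders: "\<And>z. poly A z = 0 \<Longrightarrow> 3 dvd order z A" "\<And>z. poly B z = 0 \<Longrightarrow> 3 dvd order z B"
    and deg: "max (degree A) (degree B) = 3 * k"
  shows "\<exists>z z'. z \<noteq> z' \<and> odd (order z C) \<and> odd (order z' C)"
proof -
  have "\<exists>a. smult \<alpha> A = a ^ 3"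
    by (rule poly_is_power_if_dvd_orders) (use C orders in \<open>auto simp: order_smult\<close>)
  then obtain a where a: "smult \<alpha> A = a ^ 3" by blast
  have "\<exists>b. smult (- \<beta>) B = b ^ 3"
    by (rule poly_is_power_if_dvd_orders) (use C orders in \<open>auto simp: order_smult\<close>)
  then obtain b where b: "smult (- \<beta>) B = b ^ 3" by blast
  have da: "degree A = 3 * degree a"
    using arg_cong[OF a, of degree] C by (cases "a = 0") (auto simp: degree_power_eq)
  have db: "degree B = 3 * degree b"
    using arg_cong[OF b, of degree] C by (cases "b = 0") (auto simp: degree_power_eq)
  have ra: "poly A z = 0" if "poly a z = 0" for z
    using arg_cong[OF a, of "\<lambda>p. poly p z"] that C by simp
  have rb: "poly B z = 0" if "poly b z = 0" for z
    using arg_cong[OF b, of "\<lambda>p. poly p z"] that C by simp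
  have "C = a ^ 3 - b ^ 3"
    unfolding C(1) a b[symmetric] by simp
  moreover have "\<exists>z z'. z \<noteq> z' \<and> odd (order z (a ^ 3 - b ^ 3)) \<and> odd (order z' (a ^ 3 - b ^ 3))"
    by (rule difference_of_cubes_odd_orders[OF \<open>odd k\<close>])
       (use deg da db ra rb coprime in \<open>auto simp: max_def split: if_splits\<close>)
  ultimately show ?thesis by simp
qed

section \<open>Ramification indices in centred coordinates\<close>

lemma open_inverse_vimage:
  fixes X :: "complex set"
  assumes "open X"
  shows "open {w. w \<noteq> 0 \<and> inverse w \<in> X}"
proof -
  have "open ((-{0}) \<inter> inverse -` X)"
    by (rule continuous_open_preimage) (auto intro!: continuous_intros assms)
  moreover have "(-{0}) \<inter> inverse -` X = {w. w \<noteq> 0 \<and> inverse w \<in> X}" by auto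
  ultimately show ?thesis by simp
qed

text \<open>
  Openness can be tested in the two charts. This makes the two charts interchangeable, although the
  one-point compactification treats infinity separately.
\<close>
lemma openin_sphere_top_iff:
  "openin sphere_top U \<longleftrightarrow> open (Some -` U) \<and> open (infty_param -` U)"
proof
  assume "openin sphere_top U"
  then consider (finite) X where "open X" "U = Some ` X"
    | (infinite) C where "compact C" "U = insert None (Some ` (- C))"
    unfolding sphere_top_def openin_Alexandroff_compactification
    by (auto simp: Compl_eq_Diff_UNIV)
  then show "open (Some -` U) \<and> open (infty_param -` U)"
  proof cases
    case finite
    have "infty_param -` U = {w. w \<noteq> 0 \<and> inverse w \<in> X}"
      using finite by (auto simp: infty_param_def split: if_splits)
    then show ?thesis using finite open_inverse_vimage[of X] by (simp add: inj_vimage_image_eq)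
  next
    case infinite
    obtain B where B: "B > 0" "\<And>z. z \<in> C \<Longrightarrow> norm z \<le> B"
      using compact_imp_bounded[OF infinite(1)] bounded_pos by metis
    have oC: "open (- C)" using infinite(1) compact_imp_closed by auto
    have "infty_param -` U = {w. w \<noteq> 0 \<and> inverse w \<in> - C} \<union> ball 0 (inverse B)"
    proof (intro equalityI subsetI)
      fix w assume "w \<in> infty_param -` U"
      then show "w \<in> {w. w \<noteq> 0 \<and> inverse w \<in> - C} \<union> ball 0 (inverse B)"
        using infinite B by (auto simp: infty_param_def split: if_splits)
    next
      fix w assume w: "w \<in> {w. w \<noteq> 0 \<and> inverse w \<in> - C} \<union> ball 0 (inverse B)"
      have "inverse w \<notin> C" if "w \<noteq> 0" "norm w < inverse B"
      proof
        assume "inverse w \<in> C"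
        then have "inverse (norm w) \<le> B" using B(2) by (metis norm_inverse)
        moreover have "B < inverse (norm w)"
          using that B(1) by (metis inverse_inverse_eq less_imp_inverse_less zero_less_norm_iff)
        ultimately show False by simp
      qed
      with w show "w \<in> infty_param -` U"
        using infinite by (auto simp: infty_param_def)
    qed
    moreover have "Some -` U = - C" using infinite by auto
    ultimately show ?thesis using open_inverse_vimage[OF oC] oC by auto
  qed
next
  assume opens: "open (Some -` U) \<and> open (infty_param -` U)"
  show "openin sphere_top U"
  proof (cases "None \<in> U")
    case False
    then have "U = Some ` (Some -` U)"
      by (auto simp: image_iff) (metis not_None_eq)
    then show ?thesis
      using opens unfolding sphere_top_def openin_Alexandroff_compactification by auto
  next
    case True
    then have "0 \<in> infty_param -` U" by (simp add: infty_param_def)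
    then obtain r where r: "r > 0" "ball 0 r \<subseteq> infty_param -` U"
      using opens openE by blast
    have "norm z \<le> inverse r" if "z \<in> - (Some -` U)" for z
    proof (rule ccontr)
      assume *: "\<not> norm z \<le> inverse r"
      then have "z \<noteq> 0" using r by auto
      have "norm (inverse z) < r"
        using * r by (metis inverse_inverse_eq less_imp_inverse_less norm_inverse not_le
            positive_imp_inverse_positive)
      then have "infty_param (inverse z) \<in> U" using r by auto
      then show False using that \<open>z \<noteq> 0\<close> by (simp add: infty_param_def)
    qed
    then have "compact (- (Some -` U))"
      using opens by (auto simp: compact_eq_bounded_closed bounded_iff)
    moreover have "U = insert None (Some ` (UNIV - (- (Some -` U))))"
      using True by (auto simp: image_iff)
    moreover have "closed (- (Some -` U))" using opens by auto
    ultimately show ?thesis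
      unfolding sphere_top_def openin_Alexandroff_compactification topspace_euclidean
      by (intro disjI2 exI[of _ "- (Some -` U)"]) simp
  qed
qed

text \<open>
  A coordinate around every point of the sphere, sending \<open>0\<close> to that point, so that finite points
  and infinity can be treated alike.
\<close>
definition centred_param :: "sphere \<Rightarrow> complex \<Rightarrow> sphere" where
  "centred_param q w = (case q of None \<Rightarrow> infty_param w | Some a \<Rightarrow> Some (a + w))"

definition centred_chart :: "sphere \<Rightarrow> sphere \<Rightarrow> complex" where
  "centred_chart q x = (case q of None \<Rightarrow> infty_chart x | Some a \<Rightarrow> finite_chart x - a)"

lemma centred_chart_param [simp]: "centred_chart q (centred_param q w) = w"
  by (cases q) (auto simp: centred_chart_def centred_param_def infty_chart_def infty_param_def
      finite_chart_def)

lemma centred_param_0 [simp]: "centred_param q 0 = q"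
  by (cases q) (auto simp: centred_param_def infty_param_def)

lemma inj_centred_param: "inj (centred_param q)"
  by (metis centred_chart_param injI)

text \<open>
  An abstract local coordinate, read in the centred coordinate, is an injective holomorphic function
  of one complex variable.
\<close>
lemma local_coordinate_in_param:
  assumes "local_coordinate q U \<phi>"
  defines "W \<equiv> centred_param q -` U" and "\<Phi> \<equiv> \<phi> \<circ> centred_param q"
  shows "open W" "0 \<in> W" "\<Phi> holomorphic_on W" "inj_on \<Phi> W" "\<Phi> 0 = 0"
proof -
  have U: "openin sphere_top U" "q \<in> U" "holomorphic_fun_on \<phi> U" "inj_on \<phi> U" "\<phi> q = 0"
    using assms(1) unfolding local_coordinate_def by auto
  show "0 \<in> W" "\<Phi> 0 = 0" using U by (auto simp: W_def \<Phi>_def)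
  show "inj_on \<Phi> W"
    unfolding \<Phi>_def W_def
    by (rule comp_inj_on) (auto intro: inj_on_subset[OF inj_centred_param] inj_on_subset[OF U(4)])
  have "open W \<and> \<Phi> holomorphic_on W"
  proof (cases q)
    case None
    have *: "centred_param q = infty_param"
      using None by (auto simp: centred_param_def)
    show ?thesis
      using U unfolding W_def \<Phi>_def * by (auto simp: openin_sphere_top_iff holomorphic_fun_on_def)
  next
    case (Some a)
    have *: "centred_param q = Some \<circ> (\<lambda>w. a + w)"
      using Some by (auto simp: centred_param_def)
    have W: "W = (\<lambda>w. a + w) -` (Some -` U)" unfolding W_def * by auto
    have "open W"
      unfolding W using U(1) by (intro continuous_open_vimage) (auto simp: openin_sphere_top_iff intro!: continuous_intros)
    moreover have "((\<phi> \<circ> Some) \<circ> (\<lambda>w. a + w)) holomorphic_on W"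
      by (rule holomorphic_on_compose_gen[where t = "Some -` U"])
         (use U in \<open>auto simp: holomorphic_fun_on_def W intro!: holomorphic_intros\<close>)
    ultimately show ?thesis unfolding \<Phi>_def * by (simp add: comp_assoc)
  qed
  then show "open W" "\<Phi> holomorphic_on W" by auto
qed

lemma local_coordinate_from_param:
  assumes "open W" "0 \<in> W" "h holomorphic_on W" "inj_on h W" "h 0 = 0"
  shows "local_coordinate q (centred_param q ` W) (h \<circ> centred_chart q)"
proof -
  have hol: "(\<lambda>w. h (g w)) holomorphic_on S" if "g holomorphic_on S" "g ` S \<subseteq> W" for g S
    using holomorphic_on_compose_gen[OF that(1) assms(3)] that(2) by (simp add: o_def image_subset_iff_funcset)
  have "openin sphere_top (centred_param q ` W) \<and> holomorphic_fun_on (h \<circ> centred_chart q) (centred_param q ` W)"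
  proof (cases q)
    case None
    have *: "centred_param q = infty_param"
      using None by (auto simp: centred_param_def)
    have "Some z = infty_param w \<longleftrightarrow> z \<noteq> 0 \<and> w = inverse z" for z w
      by (auto simp: infty_param_def)
    then have "Some -` (centred_param q ` W) = {z. z \<noteq> 0 \<and> inverse z \<in> W}"
      unfolding * by (auto simp: image_iff)
    moreover have "infty_param -` (centred_param q ` W) = W"
      using inj_centred_param[of q] unfolding * by (rule inj_vimage_image_eq)
    moreover have "(h \<circ> centred_chart q) \<circ> Some = (\<lambda>z. h (inverse z))"
      using None by (auto simp: centred_chart_def infty_chart_def)
    moreover have "(h \<circ> centred_chart q) \<circ> infty_param = h"
      using None by (auto simp: centred_chart_def infty_chart_def infty_param_def)
    ultimately show ?thesis
      using assms open_inverse_vimage[of W]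
      by (auto simp: openin_sphere_top_iff holomorphic_fun_on_def intro!: hol holomorphic_intros)
  next
    case (Some a)
    have 1: "Some -` (centred_param q ` W) = {z. z - a \<in> W}"
      using Some by (force simp: centred_param_def image_iff)
    have 2: "infty_param -` (centred_param q ` W) = {w. w \<noteq> 0 \<and> inverse w \<in> {z. z - a \<in> W}}"
      unfolding 1[symmetric] using Some
      by (auto simp: centred_param_def infty_param_def split: if_splits)
    have op: "open {z. z - a \<in> W}"
      using continuous_open_vimage[of W "\<lambda>z. z - a"] assms(1)
      by (auto simp: vimage_def intro!: continuous_intros)
    have 3: "(h \<circ> centred_chart q) \<circ> Some = (\<lambda>z. h (z - a))"
      using Some by (auto simp: centred_chart_def finite_chart_def)
    have "((h \<circ> centred_chart q) \<circ> infty_param) holomorphic_on {w. w \<noteq> 0 \<and> inverse w \<in> {z. z - a \<in> W}}"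
      by (subst holomorphic_cong[OF refl, where g = "\<lambda>w. h (inverse w - a)"])
         (use Some in \<open>auto simp: centred_chart_def finite_chart_def infty_param_def intro!: hol holomorphic_intros\<close>)
    then show ?thesis
      using op open_inverse_vimage[OF op] unfolding openin_sphere_top_iff holomorphic_fun_on_def 1 2 3
      by (auto intro!: hol holomorphic_intros)
  qed
  moreover have "inj_on (h \<circ> centred_chart q) (centred_param q ` W)"
    using assms(4) by (auto simp: inj_on_def)
  moreover have "q \<in> centred_param q ` W" by (metis assms(2) centred_param_0 imageI)
  moreover have "centred_chart q q = 0" by (metis centred_chart_param centred_param_0)
  ultimately show ?thesis using assms(5) by (simp add: local_coordinate_def)
qed

text \<open>
  An injective holomorphic function can only have simple zeros; this is what makes the exponent in
  a local form independent of the coordinates.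
\<close>
lemma injective_holomorphic_quotient_limit:
  assumes "open W" "0 \<in> W" "h holomorphic_on W" "inj_on h W" "h 0 = 0"
  obtains c where "c \<noteq> 0" "((\<lambda>w. h w / w) \<longlongrightarrow> c) (at 0)"
proof
  show "deriv h 0 \<noteq> 0" using holomorphic_injective_imp_regular assms by blast
  have "(h has_field_derivative deriv h 0) (at 0)" using holomorphic_derivI assms by blast
  then show "((\<lambda>w. h w / w) \<longlongrightarrow> deriv h 0) (at 0)"
    using assms(5) by (simp add: has_field_derivative_iff)
qed

lemma power_quotient_limit_nonzero_imp_eq:
  assumes lim: "((\<lambda>w::complex. w ^ e / w ^ n) \<longlongrightarrow> c) (at 0)" and "c \<noteq> 0"
  shows "e = n"
proof (rule ccontr)
  have small: "((\<lambda>w::complex. w ^ i / w ^ j) \<longlongrightarrow> 0) (at 0)" if "j < i" for i j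
  proof -
    have "((\<lambda>w::complex. w ^ (i - j)) \<longlongrightarrow> 0 ^ (i - j)) (at 0)"
      by (intro tendsto_intros)
    then have "((\<lambda>w::complex. w ^ (i - j)) \<longlongrightarrow> 0) (at 0)"
      using that by (simp add: power_0_left)
    moreover have "\<forall>\<^sub>F w::complex in at 0. w ^ (i - j) = w ^ i / w ^ j"
      using that by (auto simp: eventually_at_filter power_diff)
    ultimately show ?thesis by (rule Lim_transform_eventually)
  qed
  assume "e \<noteq> n"
  then consider "n < e" | "e < n" by linarith
  then show False
  proof cases
    case 1
    then show False using tendsto_unique[OF _ lim small] \<open>c \<noteq> 0\<close> by auto
  next
    case 2
    have "((\<lambda>w::complex. inverse (w ^ e / w ^ n)) \<longlongrightarrow> inverse c) (at 0)"
      using lim \<open>c \<noteq> 0\<close> by (rule tendsto_inverse)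
    then have "((\<lambda>w::complex. w ^ n / w ^ e) \<longlongrightarrow> inverse c) (at 0)" by simp
    then have "inverse c = 0" using tendsto_unique[OF _ _ small[OF 2]] by (metis trivial_limit_at)
    then show False using \<open>c \<noteq> 0\<close> by simp
  qed
qed

lemma holomorphic_nth_root_near:
  assumes "open W" "0 \<in> W" "g holomorphic_on W" "g 0 \<noteq> (0::complex)" "n \<ge> (1::nat)"
  obtains r s where "r > 0" "ball 0 r \<subseteq> W" "s holomorphic_on ball 0 r" "s 0 \<noteq> 0"
    "\<And>w. w \<in> ball 0 r \<Longrightarrow> g w = s w ^ n"
proof -
  have "continuous_on W g" using assms(3) holomorphic_on_imp_continuous_on by blast
  then have "open (W \<inter> g -` (- {0}))" using assms(1) by (intro continuous_open_preimage) auto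
  then obtain r where r: "r > 0" "ball 0 r \<subseteq> W \<inter> g -` (- {0})"
    using assms by (metis (no_types, lifting) ComplI IntI openE singletonD vimageI)
  have "g holomorphic_on ball 0 r" using assms(3) r holomorphic_on_subset by blast
  then obtain l where l: "l holomorphic_on ball 0 r" "\<And>w. w \<in> ball 0 r \<Longrightarrow> g w = exp (l w)"
    using r by (rule_tac contractible_imp_holomorphic_log[of g "ball 0 r"]) (auto intro: convex_imp_contractible)
  show ?thesis
  proof
    show "r > 0" "ball 0 r \<subseteq> W" using r by auto
    show "(\<lambda>w. exp (l w / of_nat n)) holomorphic_on ball 0 r"
      by (intro holomorphic_intros l) (use assms in auto)
    show "exp (l 0 / of_nat n) \<noteq> 0" by simp
    show "g w = exp (l w / of_nat n) ^ n" if "w \<in> ball 0 r" for w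
      using l(2)[OF that] assms(5) by (simp flip: exp_of_nat_mult)
  qed
qed

text \<open>
  The exponent \<open>n\<close> is attained by the coordinate \<open>w * s w\<close>, where \<open>s\<close> is an \<open>n\<close>-th root of \<open>g\<close>.
  It is the only one: if \<open>\<Phi>\<close> and \<open>\<Psi>\<close> are the coordinates of a local form with exponent \<open>e\<close>, then
  \<open>\<Psi> (w ^ n * g w) = \<Phi> w ^ e\<close>, and as \<open>\<Phi>\<close> and \<open>\<Psi>\<close> have simple zeros the two sides vanish
  at \<open>0\<close> to the orders \<open>n\<close> and \<open>e\<close>.
\<close>
theorem ramification_index_eqI:
  assumes W: "open W" "0 \<in> W" and g: "g holomorphic_on W" "g 0 \<noteq> 0" and n: "n \<ge> 1"
    and f: "\<And>w. w \<in> W \<Longrightarrow> f (centred_param q w) = centred_param (f q) (w ^ n * g w)"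
  shows "ramification_index f q = n"
  unfolding ramification_index_def
proof (rule the_equality)
  obtain r s where r: "r > 0" "ball 0 r \<subseteq> W" and s: "s holomorphic_on ball 0 r" "s 0 \<noteq> 0"
    "\<And>w. w \<in> ball 0 r \<Longrightarrow> g w = s w ^ n"
    using holomorphic_nth_root_near[OF W g n] by blast
  define h where "h w = w * s w" for w
  have h: "h holomorphic_on ball 0 r" unfolding h_def by (intro holomorphic_intros s)
  have "(s has_field_derivative deriv s 0) (at 0)" using holomorphic_derivI s(1) r(1) by (metis centre_in_ball open_ball)
  then have "(h has_field_derivative s 0) (at 0)"
    unfolding h_def by (auto intro!: derivative_eq_intros)
  then have "deriv h 0 \<noteq> 0" using s(2) by (simp add: DERIV_imp_deriv)
  then obtain r' where r': "r' > 0" "ball (0::complex) r' \<subseteq> ball 0 r" "inj_on h (ball 0 r')"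
    using has_complex_derivative_locally_injective[OF h centre_in_ball[THEN iffD2] open_ball, OF r(1)]
    by metis
  have "has_local_form f q n"
    unfolding has_local_form_def
  proof (intro exI conjI ballI)
    show "local_coordinate q (centred_param q ` ball 0 r') (h \<circ> centred_chart q)"
      by (rule local_coordinate_from_param) (use r' h in \<open>auto simp: h_def intro: holomorphic_on_subset\<close>)
    show "local_coordinate (f q) (centred_param (f q) ` UNIV) (id \<circ> centred_chart (f q))"
      by (rule local_coordinate_from_param) auto
    show "f ` (centred_param q ` ball 0 r') \<subseteq> range (centred_param (f q))"
      using f r r' by auto
    fix x assume "x \<in> centred_param q ` ball 0 r'"
    then obtain w where w: "w \<in> ball 0 r'" "x = centred_param q w" by blast
    then have "w \<in> ball 0 r" using r' by blast
    with w show "(id \<circ> centred_chart (f q)) (f x) = (h \<circ> centred_chart q) x ^ n"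
      using f[of w] r s(3)[of w] by (auto simp: h_def power_mult_distrib)
  qed
  then show "n \<ge> 1 \<and> has_local_form f q n" using n by simp
next
  fix e assume "e \<ge> 1 \<and> has_local_form f q e"
  then obtain U \<phi> V \<psi> where U: "local_coordinate q U \<phi>" and V: "local_coordinate (f q) V \<psi>"
    and sub: "f ` U \<subseteq> V" and eq: "\<And>x. x \<in> U \<Longrightarrow> \<psi> (f x) = \<phi> x ^ e"
    unfolding has_local_form_def by blast
  define \<Phi> \<Psi> where "\<Phi> = \<phi> \<circ> centred_param q" and "\<Psi> = \<psi> \<circ> centred_param (f q)"
  note U' = local_coordinate_in_param[OF U, folded \<Phi>_def]
  note V' = local_coordinate_in_param[OF V, folded \<Psi>_def]
  obtain c where c: "c \<noteq> 0" "((\<lambda>w. \<Phi> w / w) \<longlongrightarrow> c) (at 0)"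
    using injective_holomorphic_quotient_limit[OF U'] by blast
  obtain b where b: "b \<noteq> 0" "((\<lambda>w. \<Psi> w / w) \<longlongrightarrow> b) (at 0)"
    using injective_holomorphic_quotient_limit[OF V'] by blast
  define v where "v w = w ^ n * g w" for w
  have g_lim: "(g \<longlongrightarrow> g 0) (at 0)"
    using g(1) W by (metis at_within_open continuous_on holomorphic_on_imp_continuous_on)
  have g_nz: "\<forall>\<^sub>F w in at 0. g w \<noteq> 0"
    using g_lim g(2) by (rule tendsto_imp_eventually_ne)
  have "(v \<longlongrightarrow> 0 ^ n * g 0) (at 0)"
    unfolding v_def by (intro tendsto_intros g_lim)
  moreover have "\<forall>\<^sub>F w in at 0. v w \<noteq> 0"
    using g_nz eventually_neq_at_within[of 0] by eventually_elim (auto simp: v_def)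
  ultimately have v_lim: "filterlim v (at 0) (at 0)"
    using n by (simp add: filterlim_at power_0_left)
  \<comment> \<open>The quotient \<open>w ^ e / w ^ n\<close> is written in terms of the functions \<open>\<Psi> v / v\<close>, \<open>g\<close> and
    \<open>\<Phi> w / w\<close>, whose limits are finite and nonzero.\<close>
  have num: "((\<lambda>w. \<Psi> (v w) / v w * g w) \<longlongrightarrow> b * g 0) (at 0)"
    by (intro tendsto_mult g_lim filterlim_compose[OF b(2) v_lim])
  have den: "((\<lambda>w. (\<Phi> w / w) ^ e) \<longlongrightarrow> c ^ e) (at 0)"
    using c(2) by (rule tendsto_power)
  have den_nz: "\<forall>\<^sub>F w in at 0. (\<Phi> w / w) ^ e \<noteq> 0"
    by (rule tendsto_imp_eventually_ne[OF den]) (use c in simp)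
  have "((\<lambda>w. (\<Psi> (v w) / v w * g w) / (\<Phi> w / w) ^ e) \<longlongrightarrow> b * g 0 / c ^ e) (at 0)"
    by (rule tendsto_divide[OF num den]) (use c in simp)
  moreover have "\<forall>\<^sub>F w in at 0. (\<Psi> (v w) / v w * g w) / (\<Phi> w / w) ^ e = w ^ e / w ^ n"
  proof -
    have "\<forall>\<^sub>F w in at 0. w \<in> W" "\<forall>\<^sub>F w in at 0. w \<in> centred_param q -` U"
      using eventually_at_in_open'[OF W] eventually_at_in_open'[OF U'(1,2)] by auto
    with g_nz den_nz eventually_neq_at_within[of 0]
    show ?thesis
    proof eventually_elim
      case (elim w)
      have "\<Psi> (v w) = \<Phi> w ^ e"
        using eq[of "centred_param q w"] f[of w] elim by (simp add: \<Psi>_def \<Phi>_def v_def)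
      then show ?case using elim by (auto simp: v_def power_divide field_simps)
    qed
  qed
  ultimately have "((\<lambda>w. w ^ e / w ^ n) \<longlongrightarrow> b * g 0 / c ^ e) (at 0)"
    by (rule Lim_transform_eventually)
  then show "e = n"
    by (rule power_quotient_limit_nonzero_imp_eq) (use b c g in auto)
qed

section \<open>Holomorphic self-maps of the sphere are rational\<close>

lemma openin_sphere_top_Some_image: "openin sphere_top (Some ` X) \<longleftrightarrow> open X"
  unfolding sphere_top_def by simp

lemma openin_sphere_top_outside_disc: "openin sphere_top (insert None (Some ` {z. r < norm z}))"
proof -
  have "{z::complex. r < norm z} = UNIV - cball 0 r" by auto
  then show ?thesis
    unfolding sphere_top_def openin_Alexandroff_compactification
    by (intro disjI2 exI[of _ "cball 0 r"]) auto
qed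

lemma eventually_Some_in_open_at_infinity:
  assumes "openin sphere_top U" "None \<in> U"
  shows "\<forall>\<^sub>F z in at_infinity. Some z \<in> U"
proof -
  obtain C where "compact C" "U = insert None (Some ` (- C))"
    using assms unfolding sphere_top_def openin_Alexandroff_compactification
    by (auto simp: Compl_eq_Diff_UNIV)
  moreover obtain B where "\<And>z. z \<in> C \<Longrightarrow> norm z \<le> B"
    using compact_imp_bounded[OF \<open>compact C\<close>] bounded_iff by metis
  ultimately show ?thesis
    unfolding eventually_at_infinity by (intro exI[of _ "B + 1"]) force
qed

text \<open>
  Each pole is removed by multiplying with the power of \<open>z - s\<close> that gives its order. That the
  entire numerator does not vanish at the poles makes the quotient reduced.
\<close>
lemma holomorphic_with_poles_eq_quotient:
  assumes "finite S" "F holomorphic_on - S" "\<And>s. s \<in> S \<Longrightarrow> is_pole F s"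
  shows "\<exists>G D. G holomorphic_on UNIV \<and> (\<forall>z. poly D z = 0 \<longleftrightarrow> z \<in> S) \<and> (\<forall>z\<in>S. G z \<noteq> 0) \<and>
           (\<forall>z. z \<notin> S \<longrightarrow> F z = G z / poly D z)"
  using assms
proof (induction S arbitrary: F rule: finite_induct)
  case empty
  then show ?case by (intro exI[of _ F] exI[of _ 1]) auto
next
  case (insert s S)
  have op: "open (- S)" "s \<in> - S"
    using insert by (auto intro: finite_imp_closed)
  have "F holomorphic_on - S - {s}"
    using insert.prems(1) by (rule holomorphic_on_subset) auto
  note * = zorder_exist_pole[OF this op insert.prems(2)[OF insertI1]]
  define h n where "h = zor_poly F s" and "n = nat (- zorder F s)"
  obtain r where r: "r > 0" "h s \<noteq> 0" "h holomorphic_on cball s r"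
    "\<And>w. w \<in> cball s r - {s} \<Longrightarrow> F w = h w / (w - s) ^ n"
    using * unfolding h_def n_def by meson
  have "n > 0" using * unfolding n_def by linarith
  \<comment> \<open>The product with \<open>(w - s) ^ n\<close>, continued holomorphically to \<open>s\<close>.\<close>
  define F' where "F' w = (if w = s then h s else F w * (w - s) ^ n)" for w
  have near: "F' w = h w" if "w \<in> cball s r" for w
    using r(4)[of w] that by (auto simp: F'_def)
  have off: "F' holomorphic_on - S - {s}"
  proof (rule holomorphic_transform)
    show "(\<lambda>w. F w * (w - s) ^ n) holomorphic_on - S - {s}"
      by (intro holomorphic_intros) fact
  qed (auto simp: F'_def)
  have "F' holomorphic_on ball s r"
    by (rule holomorphic_transform[of h]) (use r near in \<open>auto intro: holomorphic_on_subset\<close>)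
  then have "F' holomorphic_on (- S - {s}) \<union> ball s r"
    using off op by (intro holomorphic_on_Un) (auto intro: open_Diff)
  then have "F' holomorphic_on - S"
    by (rule holomorphic_on_subset) (use r in auto)
  moreover have "is_pole F' t" if "t \<in> S" for t
  proof -
    have "t \<noteq> s" using that insert by auto
    have "((\<lambda>w. (w - s) ^ n) \<longlongrightarrow> (t - s) ^ n) (at t)" by (intro tendsto_intros)
    moreover have "(t - s) ^ n \<noteq> 0" using \<open>t \<noteq> s\<close> by simp
    ultimately have "is_pole (\<lambda>w. (w - s) ^ n * F w) t"
      using insert.prems(2)[of t] that unfolding is_pole_def
      by (intro tendsto_mult_filterlim_at_infinity) auto
    moreover have "\<forall>\<^sub>F w in at t. F' w = (w - s) ^ n * F w"
    proof -
      have "\<forall>\<^sub>F w in at t. w \<noteq> s" using tendsto_imp_eventually_ne[OF tendsto_ident_at \<open>t \<noteq> s\<close>] .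
      then show ?thesis by eventually_elim (simp add: F'_def)
    qed
    ultimately show ?thesis by (simp add: is_pole_cong[OF _ refl])
  qed
  ultimately have "\<exists>G D. G holomorphic_on UNIV \<and> (\<forall>z. poly D z = 0 \<longleftrightarrow> z \<in> S) \<and> (\<forall>z\<in>S. G z \<noteq> 0) \<and>
      (\<forall>z. z \<notin> S \<longrightarrow> F' z = G z / poly D z)"
    by (rule insert.IH)
  then obtain G D where G: "G holomorphic_on UNIV" "\<And>z. poly D z = 0 \<longleftrightarrow> z \<in> S"
      "\<And>z. z \<in> S \<Longrightarrow> G z \<noteq> 0" "\<And>z. z \<notin> S \<Longrightarrow> F' z = G z / poly D z"
    by metis
  define E where "E = D * [:- s, 1:] ^ n"
  have E: "poly E z = poly D z * (z - s) ^ n" for z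
    by (simp add: E_def)
  have "G s \<noteq> 0"
    using G(4)[of s] r(2) insert.hyps by (auto simp: F'_def)
  moreover have "F z = G z / poly E z" if "z \<notin> insert s S" for z
    using G(2)[of z] G(4)[of z] that by (simp add: E F'_def field_simps)
  moreover have "poly E z = 0 \<longleftrightarrow> z \<in> insert s S" for z
    using G(2)[of z] \<open>n > 0\<close> by (auto simp: E)
  ultimately show ?case
    using G(1,3) by (intro exI[of _ G] exI[of _ E]) blast
qed

lemma entire_with_limit_at_infinity_is_poly:
  assumes "f holomorphic_on UNIV" "((inverse \<circ> f) \<longlongrightarrow> l) at_infinity"
  obtains p where "\<And>z. f z = poly p z"
proof -
  obtain a n where a: "\<And>z. f z = (\<Sum>i\<le>n. a i * z ^ i)"
    using pole_at_infinity[OF assms] by blast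
  have "poly (\<Sum>i\<le>n. monom (a i) i) z = f z" for z
    unfolding a by (simp add: poly_sum poly_monom)
  then show thesis using that by metis
qed

definition sphere_quotient :: "complex poly \<Rightarrow> complex poly \<Rightarrow> complex \<Rightarrow> sphere" where
  "sphere_quotient P Q z = (if poly Q z = 0 then None else Some (poly P z / poly Q z))"

text \<open>
  Off its finitely many poles \<open>f\<close> is a quotient of an entire function \<open>G\<close> and a polynomial \<open>D\<close>;
  it remains to see that \<open>G\<close> is a polynomial. For this it suffices that \<open>1 / H\<close> has a finite limit
  at infinity, where \<open>H = G - c D\<close>. Since \<open>H = (f - c) D\<close> and \<open>1 / D\<close> has a finite limit, any \<open>c\<close>
  other than the value of \<open>f\<close> at infinity will do, and no order at infinity has to be known.
\<close>
theorem holomorphic_sphere_map_rational: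
  assumes hol: "holomorphic_sphere_map f" and fin: "finite (f -` {None})"
  obtains P Q where "\<And>z. \<not> (poly P z = 0 \<and> poly Q z = 0)"
    "\<And>z. f (Some z) = sphere_quotient P Q z"
proof -
  define F where "F z = finite_chart (f (Some z))" for z
  define S where "S = {z. f (Some z) = None}"
  have fF: "f (Some z) = Some (F z)" if "z \<notin> S" for z
    using that by (auto simp: F_def S_def finite_chart_def)
  have "finite (Some -` (f -` {None}))"
    using fin by (rule finite_vimageI) simp
  then have finS: "finite S" by (simp add: S_def vimage_def)
  have preim: "openin sphere_top (f -` U)" if "openin sphere_top U" for U
  proof -
    have "topspace sphere_top = UNIV"
      by (simp add: sphere_top_def UNIV_option_conv)
    then show ?thesis
      using hol that unfolding holomorphic_sphere_map_def continuous_map_def by (simp add: vimage_def)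
  qed
  have holF: "F holomorphic_on - S"
  proof -
    have "((finite_chart \<circ> f) \<circ> Some) holomorphic_on Some -` (f -` (- {None}))"
      using hol unfolding holomorphic_sphere_map_def holomorphic_fun_on_def by blast
    moreover have "(finite_chart \<circ> f) \<circ> Some = F" by (auto simp: F_def)
    moreover have "Some -` (f -` (- {None})) = - S" by (auto simp: S_def)
    ultimately show ?thesis by simp
  qed
  have pole: "is_pole F s" if "s \<in> S" for s
    unfolding is_pole_def filterlim_at_infinity[OF order_refl]
  proof (intro allI impI)
    fix r :: real
    let ?U = "insert None (Some ` {z. r < norm z})"
    have "open (Some -` (f -` ?U))"
      using preim[OF openin_sphere_top_outside_disc] openin_sphere_top_iff by blast
    moreover have "s \<in> Some -` (f -` ?U)" using that by (simp add: S_def)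
    ultimately have "\<forall>\<^sub>F z in at s. z \<in> Some -` (f -` ?U)" by (rule eventually_at_in_open')
    moreover have "\<forall>\<^sub>F z in at s. z \<notin> S"
    proof -
      have "\<forall>\<^sub>F z in at s. z \<in> - (S - {s}) - {s}"
        by (intro eventually_at_in_open open_Compl finite_imp_closed) (use finS in auto)
      then show ?thesis by eventually_elim auto
    qed
    ultimately show "\<forall>\<^sub>F z in at s. r \<le> norm (F z)"
      by eventually_elim (auto simp: fF)
  qed
  have evS: "\<forall>\<^sub>F z in at_infinity. z \<notin> S"
  proof -
    obtain B where "\<And>z. z \<in> S \<Longrightarrow> norm z \<le> B"
      using finite_imp_bounded[OF finS] bounded_iff by metis
    then show ?thesis unfolding eventually_at_infinity by (intro exI[of _ "B + 1"]) force
  qed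
  obtain c l where c: "((\<lambda>z. inverse (F z - c)) \<longlongrightarrow> l) at_infinity"
  proof -
    have ev: "\<forall>\<^sub>F z in at_infinity. Some (F z) \<in> U" if "openin sphere_top U" "f None \<in> U" for U
    proof -
      have "\<forall>\<^sub>F z in at_infinity. Some z \<in> f -` U"
        using eventually_Some_in_open_at_infinity[OF preim] that by simp
      with evS show ?thesis by eventually_elim (simp add: fF)
    qed
    \<comment> \<open>The constant has to differ from the value at infinity: \<open>0\<close> if this is infinite, and
      \<open>a - 1\<close> if it is \<open>a\<close>.\<close>
    show thesis
    proof (cases "f None")
      case None
      have "filterlim F at_infinity at_infinity"
        unfolding filterlim_at_infinity[OF order_refl]
      proof (intro allI impI)
        fix r :: real
        show "\<forall>\<^sub>F z in at_infinity. r \<le> norm (F z)"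
          using ev[OF openin_sphere_top_outside_disc, of r] None
          by (auto elim!: eventually_mono)
      qed
      then have "((\<lambda>z. inverse (F z - 0)) \<longlongrightarrow> 0) at_infinity"
        using filterlim_compose[OF tendsto_inverse_0] by simp
      then show thesis by (rule that)
    next
      case (Some a)
      have "(F \<longlongrightarrow> a) at_infinity"
      proof (rule topological_tendstoI)
        fix X assume "open X" "a \<in> X"
        then show "\<forall>\<^sub>F z in at_infinity. F z \<in> X"
          using ev[of "Some ` X"] Some by (auto simp: openin_sphere_top_Some_image inj_image_mem_iff)
      qed
      then have "((\<lambda>z. inverse (F z - (a - 1))) \<longlongrightarrow> inverse (a - (a - 1))) at_infinity"
        by (intro tendsto_intros) auto
      then show thesis by (rule that)
    qed
  qed
  obtain G D where G: "G holomorphic_on UNIV" "\<And>z. poly D z = 0 \<longleftrightarrow> z \<in> S"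
      "\<And>z. z \<in> S \<Longrightarrow> G z \<noteq> 0" "\<And>z. z \<notin> S \<Longrightarrow> F z = G z / poly D z"
    using holomorphic_with_poles_eq_quotient[OF finS holF pole] by blast
  have "infinite (UNIV - S)" using finS infinite_UNIV_char_0 by (metis Diff_infinite_finite)
  then have "D \<noteq> 0" using G(2) by (metis DiffD2 finite.emptyI ex_in_conv poly_0)
  define H where "H z = G z - c * poly D z" for z
  have H: "inverse (H z) = inverse (F z - c) * inverse (poly D z)" if "z \<notin> S" for z
    using G(2,4)[of z] that by (simp add: H_def field_simps)
  have "\<exists>m. ((\<lambda>z. inverse (poly D z)) \<longlongrightarrow> m) at_infinity"
  proof (cases "degree D = 0")
    case True
    then obtain d where "D = [:d:]" by (metis degree_eq_zeroE)
    then show ?thesis by auto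
  next
    case False
    then have "filterlim (poly D) at_infinity at_infinity"
      by (intro filterlim_poly_at_infinity) auto
    then show ?thesis using filterlim_compose[OF tendsto_inverse_0] by blast
  qed
  then obtain m where "((\<lambda>z. inverse (poly D z)) \<longlongrightarrow> m) at_infinity" by blast
  with c have "((\<lambda>z. inverse (F z - c) * inverse (poly D z)) \<longlongrightarrow> l * m) at_infinity"
    by (rule tendsto_mult)
  moreover have "\<forall>\<^sub>F z in at_infinity. inverse (F z - c) * inverse (poly D z) = (inverse \<circ> H) z"
  proof -
    from evS show ?thesis by eventually_elim (use H in auto)
  qed
  ultimately have "((inverse \<circ> H) \<longlongrightarrow> l * m) at_infinity" by (rule Lim_transform_eventually)
  moreover have "H holomorphic_on UNIV"
    unfolding H_def by (intro holomorphic_intros G)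
  ultimately obtain p where p: "\<And>z. H z = poly p z"
    using entire_with_limit_at_infinity_is_poly by blast
  define P where "P = p + smult c D"
  have P: "poly P z = G z" for z
    using p[of z] by (simp add: P_def H_def algebra_simps)
  show thesis
  proof
    show "\<not> (poly P z = 0 \<and> poly D z = 0)" for z
      using G(2,3) P by auto
    show "f (Some z) = sphere_quotient P D z" for z
      using fF[of z] G(2,4)[of z] P[of z] by (auto simp: sphere_quotient_def S_def)
  qed
qed

section \<open>Fibres of a rational map\<close>

text \<open>
  The member of the pencil of \<open>P\<close> and \<open>Q\<close> that belongs to \<open>p\<close>. For coprime \<open>P\<close> and \<open>Q\<close> its
  roots are the finite points over \<open>p\<close>; infinity, if it lies over \<open>p\<close>, shows only as a drop of the
  degree.
\<close>
definition fibre_poly :: "complex poly \<Rightarrow> complex poly \<Rightarrow> sphere \<Rightarrow> complex poly" where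
  "fibre_poly P Q p = (case p of None \<Rightarrow> Q | Some a \<Rightarrow> P - smult a Q)"

lemma poly_fibre_poly_eq_0_iff:
  assumes "\<And>z. \<not> (poly P z = 0 \<and> poly Q z = 0)"
  shows "poly (fibre_poly P Q p) z = 0 \<longleftrightarrow> sphere_quotient P Q z = p"
  using assms[of z] by (cases p) (auto simp: fibre_poly_def sphere_quotient_def field_simps)

text \<open>
  The coefficients of \<open>P\<close> and \<open>Q\<close> in a fibre polynomial are homogeneous coordinates of the point.
  Three such vectors in the plane are dependent, and since any two of them are not proportional,
  neither scalar vanishes.
\<close>
lemma fibre_poly_linear_dependence:
  assumes "p1 \<noteq> p2" "p1 \<noteq> p3" "p2 \<noteq> p3"
  obtains \<alpha> \<beta> where "\<alpha> \<noteq> 0" "\<beta> \<noteq> 0"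
    "fibre_poly P Q p1 = smult \<alpha> (fibre_poly P Q p2) + smult \<beta> (fibre_poly P Q p3)"
proof (cases p1)
  case None
  then obtain a b where ab: "p2 = Some a" "p3 = Some b" "a \<noteq> b" using assms by (metis not_None_eq)
  let ?\<gamma> = "1 / (b - a)"
  have "smult ?\<gamma> (P - smult a Q) + smult (- ?\<gamma>) (P - smult b Q) = smult (?\<gamma> * (b - a)) Q"
    by (simp add: smult_diff_right right_diff_distrib smult_diff_left)
  with None ab show thesis
    by (intro that[of ?\<gamma> "- ?\<gamma>"]) (auto simp: fibre_poly_def)
next
  case (Some c)
  consider "p2 = None" | "p3 = None" | a b where "p2 = Some a" "p3 = Some b" by (metis not_None_eq)
  then show thesis
  proof cases
    case 1
    then obtain b where "p3 = Some b" using assms by (metis not_None_eq)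
    with 1 Some assms show thesis
      by (intro that[of "b - c" 1]) (auto simp: fibre_poly_def poly_eq_iff algebra_simps)
  next
    case 2
    then obtain a where "p2 = Some a" using assms by (metis not_None_eq)
    with 2 Some assms show thesis
      by (intro that[of 1 "a - c"]) (auto simp: fibre_poly_def poly_eq_iff algebra_simps)
  next
    case 3
    then have ne: "a \<noteq> b" "c \<noteq> a" "c \<noteq> b" using Some assms by auto
    let ?\<alpha> = "(c - b) / (a - b)" and ?\<beta> = "(a - c) / (a - b)"
    have sum: "?\<alpha> + ?\<beta> = 1" "?\<alpha> * a + ?\<beta> * b = c"
      using ne by (simp_all add: divide_simps) (simp_all add: algebra_simps)
    have "fibre_poly P Q p1 = smult (?\<alpha> + ?\<beta>) P - smult (?\<alpha> * a + ?\<beta> * b) Q"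
      unfolding sum using Some by (simp add: fibre_poly_def)
    also have "\<dots> = smult ?\<alpha> (P - smult a Q) + smult ?\<beta> (P - smult b Q)"
      by (simp add: smult_add_left smult_diff_right)
    finally show thesis
      using 3 ne by (intro that[of ?\<alpha> ?\<beta>]) (auto simp: fibre_poly_def)
  qed
qed

text \<open>
  Near \<open>z\<close> the map reads, in the coordinate centred at \<open>p\<close>, as the quotient of the fibre polynomial
  by a polynomial \<open>M\<close> without zero at \<open>z\<close>: for finite \<open>p\<close> this is \<open>Q\<close>, and for infinity, where the
  coordinate is the inverse \<open>Q / P\<close>, it is \<open>P\<close>.
\<close>
lemma ramification_index_eq_order:
  assumes coprime: "\<And>z. \<not> (poly P z = 0 \<and> poly Q z = 0)"
    and f: "\<And>z. f (Some z) = sphere_quotient P Q z"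
    and p: "f (Some z) = p" and L: "fibre_poly P Q p \<noteq> 0"
  shows "ramification_index f (Some z) = order z (fibre_poly P Q p)"
proof -
  define n where "n = order z (fibre_poly P Q p)"
  obtain R where R: "fibre_poly P Q p = [:- z, 1:] ^ n * R" "\<not> [:- z, 1:] dvd R"
    using order_decomp[OF L] unfolding n_def by blast
  define M where "M = (case p of None \<Rightarrow> P | Some a \<Rightarrow> Q)"
  have Rz: "poly R z \<noteq> 0" using R(2) by (simp add: poly_eq_0_iff_dvd)
  have root: "poly (fibre_poly P Q p) z = 0"
    using poly_fibre_poly_eq_0_iff[OF coprime] p f by metis
  then have "n \<ge> 1" using L order_root unfolding n_def by (metis less_one not_le)
  have Mz: "poly M z \<noteq> 0"
    using p f[of z] coprime[of z] by (auto simp: M_def sphere_quotient_def split: option.splits if_splits)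
  define W where "W = {w. poly M (z + w) \<noteq> 0}"
  have "open W"
    unfolding W_def by (intro open_Collect_neq continuous_intros)
  have local: "f (Some (z + w)) = centred_param p (poly (fibre_poly P Q p) (z + w) / poly M (z + w))"
    if "w \<in> W" for w
    using that coprime[of "z + w"]
    by (auto simp: f W_def M_def sphere_quotient_def centred_param_def infty_param_def
        fibre_poly_def field_simps split: option.splits)
  show ?thesis
    unfolding n_def[symmetric]
  proof (rule ramification_index_eqI[where W = W and g = "\<lambda>w. poly R (z + w) / poly M (z + w)"])
    show "open W" "n \<ge> 1" by fact+
    show "0 \<in> W" using Mz by (simp add: W_def)
    show "(\<lambda>w. poly R (z + w) / poly M (z + w)) holomorphic_on W"
      by (intro holomorphic_intros) (auto simp: W_def)
    show "poly R (z + 0) / poly M (z + 0) \<noteq> 0" using Rz Mz by simp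
    show "f (centred_param (Some z) w) = centred_param (f (Some z)) (w ^ n * (poly R (z + w) / poly M (z + w)))"
      if "w \<in> W" for w
      using local[OF that] R(1) p by (simp add: centred_param_def[of "Some z"])
  qed
qed

lemma image_mset_replicate_imp:
  assumes "image_mset r (mset_set X) = replicate_mset k m" "k > 0"
  shows "finite X" "card X = k" "\<And>x. x \<in> X \<Longrightarrow> r x = m"
proof -
  show "finite X"
    using assms by (metis image_mset_empty mset_set.infinite not_gr0 replicate_mset_eq_empty_iff)
  show "card X = k"
    using arg_cong[OF assms(1), of size] by simp
  show "r x = m" if "x \<in> X" for x
    using arg_cong[OF assms(1), of set_mset] that \<open>finite X\<close> assms(2) by auto
qed

lemma two_distinct_members_image_mset:
  assumes "finite X" "x \<in> X" "y \<in> X" "x \<noteq> y" "R (r x)" "R (r y)"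
  shows "size (filter_mset R (image_mset r (mset_set X))) \<ge> 2"
proof -
  have "size (filter_mset R (image_mset r (mset_set X))) = card {x \<in> X. R (r x)}"
    using assms(1) by (simp add: filter_mset_image_mset filter_mset_mset_set)
  moreover have "card {x, y} \<le> card {x \<in> X. R (r x)}"
    using assms by (intro card_mono) auto
  ultimately show ?thesis using assms by simp
qed

text \<open>
  The roots of the fibre polynomials see only the finite points, so their degrees may be too small.
  A fibre polynomial of degree \<open>3 * k\<close> comes from whichever of \<open>p2\<close>, \<open>p3\<close> is not the image of
  infinity: then all \<open>k\<close> points of that fibre are finite, each a root of order three.
\<close>
lemma two_odd_indices_if_two_fibres_all_three:
  assumes k: "odd k"
    and dist: "p1 \<noteq> p2" "p1 \<noteq> p3" "p2 \<noteq> p3"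
    and f: "holomorphic_sphere_map f" "\<And>p. finite (f -` {p})"
    and r2: "image_mset (ramification_index f) (mset_set (f -` {p2})) = replicate_mset k 3"
    and r3: "image_mset (ramification_index f) (mset_set (f -` {p3})) = replicate_mset k 3"
  shows "size (filter_mset odd (image_mset (ramification_index f) (mset_set (f -` {p1})))) \<ge> 2"
proof -
  have "k > 0" using k by (simp add: odd_pos)
  obtain P Q where coprime: "\<And>z. \<not> (poly P z = 0 \<and> poly Q z = 0)"
    and PQ: "\<And>z. f (Some z) = sphere_quotient P Q z"
    using holomorphic_sphere_map_rational[OF f] by metis
  let ?L = "fibre_poly P Q"
  have roots: "poly (?L p) z = 0 \<longleftrightarrow> f (Some z) = p" for p z
    using poly_fibre_poly_eq_0_iff[OF coprime] PQ by metis
  have fin: "finite (Some -` (f -` {p}))" for p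
    using f(2) by (rule finite_vimageI) simp
  \<comment> \<open>Otherwise every finite point would lie over \<open>p\<close>, but fibres are finite.\<close>
  have nz: "?L p \<noteq> 0" for p
  proof
    assume "?L p = 0"
    then have "f (Some z) = p" for z using roots[of p z] by simp
    then have "Some -` (f -` {p}) = UNIV" by auto
    then show False using fin infinite_UNIV_char_0 by metis
  qed
  have ram: "ramification_index f (Some z) = order z (?L p)" if "f (Some z) = p" for z p
    using ramification_index_eq_order[OF coprime PQ that nz] .
  have deg: "degree (?L p) = 3 * card (Some -` (f -` {p}))"
    and ord: "\<And>z. poly (?L p) z = 0 \<Longrightarrow> order z (?L p) = 3"
    and le: "card (Some -` (f -` {p})) \<le> k"
    and eq: "f None \<noteq> p \<Longrightarrow> card (Some -` (f -` {p})) = k"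
    if "image_mset (ramification_index f) (mset_set (f -` {p})) = replicate_mset k 3" for p
  proof -
    note X = image_mset_replicate_imp[OF that \<open>k > 0\<close>]
    show ord: "order z (?L p) = 3" if "poly (?L p) z = 0" for z
      using X(3) ram[of z p] that roots by auto
    have "degree (?L p) = (\<Sum>z | poly (?L p) z = 0. order z (?L p))"
      using degree_eq_sum_order_complex[OF nz] .
    also have "\<dots> = 3 * card {z. poly (?L p) z = 0}"
      using ord by simp
    also have "{z. poly (?L p) z = 0} = Some -` (f -` {p})"
      using roots by auto
    finally show "degree (?L p) = 3 * card (Some -` (f -` {p}))" .
    have c: "card (Some -` (f -` {p})) = card (Some ` (Some -` (f -` {p})))"
      by (rule card_image[symmetric]) simp
    show "card (Some -` (f -` {p})) \<le> k"
      unfolding c X(2)[symmetric] by (rule card_mono) (use X(1) in auto)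
    show "card (Some -` (f -` {p})) = k" if "f None \<noteq> p"
    proof -
      have "Some ` (Some -` (f -` {p})) = f -` {p}"
        using that by (auto simp: image_iff) (metis not_None_eq)
      then show ?thesis using c X(2) by simp
    qed
  qed
  obtain \<alpha> \<beta> where ab: "\<alpha> \<noteq> 0" "\<beta> \<noteq> 0" "?L p1 = smult \<alpha> (?L p2) + smult \<beta> (?L p3)"
    using fibre_poly_linear_dependence[OF dist] by metis
  have max: "max (degree (?L p2)) (degree (?L p3)) = 3 * k"
    using deg[OF r2] deg[OF r3] le[OF r2] le[OF r3] eq[OF r2] eq[OF r3] dist
    by (cases "f None = p2") (auto simp: max_def)
  have "\<exists>z z'. z \<noteq> z' \<and> odd (order z (?L p1)) \<and> odd (order z' (?L p1))"
    by (rule three_divisible_pencil_odd_orders[OF k ab(3,1,2) _ _ _ max])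
       (use roots dist ord[OF r2] ord[OF r3] in auto)
  then obtain z z' where z: "z \<noteq> z'" "odd (order z (?L p1))" "odd (order z' (?L p1))"
    by blast
  have on: "f (Some y) = p1" if "odd (order y (?L p1))" for y
    using that roots order_0I by (metis even_zero)
  show ?thesis
    by (rule two_distinct_members_image_mset[of _ "Some z" "Some z'"])
       (use z on ram f(2) in auto)
qed

lemma candidate_datum:
  assumes "k \<ge> 3"
  shows "candidate_branch_datum (3 * k) [(k - 2) # replicate (k + 1) 2, replicate k 3, replicate k 3]"
  using assms unfolding candidate_branch_datum_def
  by (auto simp: sum_list_replicate map_replicate of_nat_diff)

theorem proposition2:
  fixes d k :: nat
  assumes "odd k" and "k \<ge> 3" and "d = 3 * k"
  shows "exceptional d [(k - 2) # replicate (k + 1) 2, replicate k 3, replicate k 3]"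
  unfolding exceptional_def
proof (intro conjI notI)
  let ?P = "[(k - 2) # replicate (k + 1) 2, replicate k 3, replicate k 3]"
  show "candidate_branch_datum d ?P"
    using candidate_datum assms by simp
  assume "\<exists>f. realized_by d ?P f"
  then obtain f ps where cover: "branched_cover f d" and ps: "distinct ps" "length ps = 3"
    and fibres: "\<And>i. i < 3 \<Longrightarrow> image_mset (ramification_index f) (mset_set (f -` {ps ! i})) = mset (?P ! i)"
    unfolding realized_by_def by auto
  have two_odd: "size (filter_mset odd (image_mset (ramification_index f) (mset_set (f -` {ps ! 0})))) \<ge> 2"
  proof (rule two_odd_indices_if_two_fibres_all_three[OF \<open>odd k\<close>])
    show "ps ! 0 \<noteq> ps ! 1" "ps ! 0 \<noteq> ps ! 2" "ps ! 1 \<noteq> ps ! 2"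
      using ps by (auto simp: nth_eq_iff_index_eq)
    show "holomorphic_sphere_map f" "finite (f -` {p})" for p
      using cover by (auto simp: branched_cover_def has_degree_def)
  qed (use fibres[of 1] fibres[of 2] in auto)
  have no_odd: "filter_mset odd (replicate_mset k (2::nat)) = {#}"
    by (induction k) auto
  show False
    using two_odd fibres[of 0] by (simp add: no_odd split: if_splits)
qed

end
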